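(* Consider the class of estimators $\mathcal{D}=\{\bar f+\psi(\bar f-\bar g)\mid \psi\ge 0\}$, where $\bar f$ and $\bar g$ are the simple means of the $J$ judges' individual predictions and peer predictions in the model described in the context. Let $D(\psi)=\bar f+\psi(\bar f-\bar g)$ be an instance of this class. Then, as crowd size increases, $$\lim_{J\to\infty}E\big[(D(\psi)-\theta)^2\big]\;\le\;\lim_{J\to\infty}E\big[(\bar f-\theta)^2\big]$$ for all values of $w\in[0,1]$ and $p\in[0,1]$ if and only if $\psi\in[0,2]$.
   Context: Nested symmetric information model. A decision maker wants to estimate the mean $\theta$ of a random variable $X$ using a crowd of $J$ judges. Crowd. The judges are divided into $J_L$ laypeople, $0\le J_L\le J$, and $J_M=J-J_L$ mavens. The proportion of mavens is $p=J_M/J$. Prior. The judges share a common prior distribution $\pi_0$ about $\theta$, with mean $\mu_0$ and finite variance $\sigma_0^2$. The prior is related to the signals by treating $\mu_0$ as the mean of $m_0$ observations of $X$. Signals. A signal is the sample mean of a certain number of i.i.d. observations of $X$, so given $\theta$ it has mean $\theta$. All judges see the public signal $s_1$, the mean of $m_1$ observations. The shared information is $s=(m_0\mu_0+m_1s_1)/m$, where $m=m_0+m_1$. Each maven $j$ also receives a private signal $t_j$, the mean of $l$ private observations of $X$. The private signals differ among mavens, but $l$ is the same for all mavens. The weight of private information is $w=l/(l+m)$. Predictions. Each judge $j$ reports a prediction $f_j$ of $\theta$ and a prediction $g_j$ of the average prediction of the other $J-1$ judges. - A layperson reports $f_j=g_j=s-\delta_j$. - A maven reports $f_j=(1-w)s+wt_j+\epsilon_j$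 and $g_j=(1-pw^2)s+pw^2t_j+pw\,\epsilon_j+\gamma_j$. Errors. The errors $\delta_j,\epsilon_j,\gamma_j$ have mean zero, are independent of one another for each $j$, and are independent between judges. Errors of the same type are identically distributed. Averages. $\bar f=\frac1J\sum_{j=1}^J f_j$ and $\bar g=\frac1J\sum_{j=1}^J g_j$. The expectation $E$ is taken over the signals and the errors given $\theta$, and then over $\theta\sim\pi_0$. The case $\psi=0$ is the simple mean $\bar f$. *)

theory Defs
  imports "HOL-Probability.Probability" "HOL-Library.Extended_Nat"
begin

datatype error_kind = Delta | Epsilon | Gamma

text \<open>
  The model is hierarchical: \<^term>\<open>theta\<close> is drawn from the prior, and a measurable kernel gives, for
  each value of \<^term>\<open>theta\<close>, the joint conditional law of all observations and errors on one sample
  space. Judges are numbered by the naturals. There is an infinite supply of potential public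
  observations, of potential private observations of every judge, and of errors; a signal averages
  an initial segment of the relevant supply, and a crowd of size \<^term>\<open>J\<close> uses the judges below
  \<^term>\<open>J\<close>. The number \<open>n_prior\<close> of observations that the prior mean counts for need not be an integer.
\<close>

record 'a crowd_model =
  prior :: "real measure"
  sample_space :: "'a measure"
  cond :: "real \<Rightarrow> 'a measure"
  X_law :: "real \<Rightarrow> real measure"
  pub_obs :: "nat \<Rightarrow> 'a \<Rightarrow> real"
  priv_obs :: "nat \<Rightarrow> nat \<Rightarrow> 'a \<Rightarrow> real"
  err_law :: "error_kind \<Rightarrow> real measure"
  err :: "error_kind \<Rightarrow> nat \<Rightarrow> 'a \<Rightarrow> real"
  n_prior :: real
  n_public :: nat
  n_private :: enat

definition prior_mean :: "'a crowd_model \<Rightarrow> real" where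
  "prior_mean C = (\<integral>\<theta>. \<theta> \<partial>prior C)"

definition prior_variance :: "'a crowd_model \<Rightarrow> real" where
  "prior_variance C = (\<integral>\<theta>. (\<theta> - prior_mean C)\<^sup>2 \<partial>prior C)"

definition X_variance :: "'a crowd_model \<Rightarrow> real \<Rightarrow> real" where
  "X_variance C \<theta> = (\<integral>x. (x - \<theta>)\<^sup>2 \<partial>X_law C \<theta>)"

definition n_shared :: "'a crowd_model \<Rightarrow> real" where
  "n_shared C = n_prior C + real (n_public C)"

definition sample_mean :: "nat \<Rightarrow> (nat \<Rightarrow> 'a \<Rightarrow> real) \<Rightarrow> 'a \<Rightarrow> real" where
  "sample_mean n Y \<omega> = (\<Sum>i<n. Y i \<omega>) / real n"

definition shared_info :: "'a crowd_model \<Rightarrow> 'a \<Rightarrow> real" where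
  "shared_info C \<omega> =
     (n_prior C * prior_mean C + real (n_public C) * sample_mean (n_public C) (pub_obs C) \<omega>)
       / n_shared C"

text \<open>
  Weight 1 is only attained in the limit of infinitely many private observations; their mean is
  then the conditional mean \<^term>\<open>theta\<close> itself (law of large numbers). For \<^term>\<open>n_private C = 0\<close> the
  value of the private signal is irrelevant, since it only ever occurs multiplied by the weight 0.
\<close>

definition private_weight :: "'a crowd_model \<Rightarrow> real" where
  "private_weight C =
     (case n_private C of enat l \<Rightarrow> real l / (real l + n_shared C) | \<infinity> \<Rightarrow> 1)"

definition private_signal :: "'a crowd_model \<Rightarrow> real \<Rightarrow> nat \<Rightarrow> 'a \<Rightarrow> real" where
  "private_signal C \<theta> j \<omega> =
     (case n_private C of enat l \<Rightarrow> sample_mean l (priv_obs C j) \<omega> | \<infinity> \<Rightarrow> \<theta>)"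

text \<open>
  The last condition excludes the degenerate case in which the shared information almost surely
  equals \<^term>\<open>theta\<close>; it also makes \<^term>\<open>n_shared C\<close> positive.
\<close>

definition nested_symmetric_model :: "'a crowd_model \<Rightarrow> bool" where
  "nested_symmetric_model C \<longleftrightarrow>
     prob_space (prior C) \<and> sets (prior C) = sets borel \<and>
     integrable (prior C) (\<lambda>\<theta>. \<theta>\<^sup>2) \<and>
     cond C \<in> prior C \<rightarrow>\<^sub>M prob_algebra (sample_space C) \<and>
     (AE \<theta> in prior C.
        integrable (X_law C \<theta>) (\<lambda>x. x\<^sup>2) \<and> (\<integral>x. x \<partial>X_law C \<theta>) = \<theta> \<and>
        prob_space.indep_vars (cond C \<theta>) (\<lambda>_. borel)
          (case_sum (pub_obs C) (case_prod (priv_obs C))) UNIV \<and>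
        (\<forall>i. distr (cond C \<theta>) borel (pub_obs C i) = X_law C \<theta>) \<and>
        (\<forall>j i. distr (cond C \<theta>) borel (priv_obs C j i) = X_law C \<theta>) \<and>
        prob_space.indep_vars (cond C \<theta>) (\<lambda>_. borel) (case_prod (err C)) UNIV \<and>
        (\<forall>k j. distr (cond C \<theta>) borel (err C k j) = err_law C k)) \<and>
     integrable (prior C) (X_variance C) \<and>
     (\<forall>k. integrable (err_law C k) (\<lambda>x. x\<^sup>2) \<and> (\<integral>x. x \<partial>err_law C k) = 0) \<and>
     0 \<le> n_prior C \<and>
     (0 < n_prior C \<and> 0 < prior_variance C \<or>
      0 < n_public C \<and> 0 < (\<integral>\<theta>. X_variance C \<theta> \<partial>prior C))"

text \<open>
  Below, \<^term>\<open>A\<close> is the set of mavens in the crowd \<open>{..<J}\<close>; the other members are laypeople.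
  Reports depend on \<^term>\<open>theta\<close> as an explicit argument only through \<^const>\<open>private_signal\<close>.
\<close>

definition maven_proportion :: "nat set \<Rightarrow> nat \<Rightarrow> real" where
  "maven_proportion A J = real (card A) / real J"

definition prediction :: "'a crowd_model \<Rightarrow> nat set \<Rightarrow> real \<Rightarrow> nat \<Rightarrow> 'a \<Rightarrow> real" where
  "prediction C A \<theta> j \<omega> =
     (let s = shared_info C \<omega>; t = private_signal C \<theta> j \<omega>; w = private_weight C in
      if j \<in> A then (1 - w) * s + w * t + err C Epsilon j \<omega>
      else s - err C Delta j \<omega>)"

definition peer_prediction ::
    "'a crowd_model \<Rightarrow> nat set \<Rightarrow> nat \<Rightarrow> real \<Rightarrow> nat \<Rightarrow> 'a \<Rightarrow> real" where
  "peer_prediction C A J \<theta> j \<omega> =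
     (let s = shared_info C \<omega>; t = private_signal C \<theta> j \<omega>; w = private_weight C;
          p = maven_proportion A J in
      if j \<in> A then (1 - p * w\<^sup>2) * s + p * w\<^sup>2 * t + p * w * err C Epsilon j \<omega> + err C Gamma j \<omega>
      else s - err C Delta j \<omega>)"

definition mean_prediction :: "'a crowd_model \<Rightarrow> nat set \<Rightarrow> nat \<Rightarrow> real \<Rightarrow> 'a \<Rightarrow> real" where
  "mean_prediction C A J \<theta> \<omega> = (\<Sum>j<J. prediction C A \<theta> j \<omega>) / real J"

definition mean_peer_prediction :: "'a crowd_model \<Rightarrow> nat set \<Rightarrow> nat \<Rightarrow> real \<Rightarrow> 'a \<Rightarrow> real" where
  "mean_peer_prediction C A J \<theta> \<omega> = (\<Sum>j<J. peer_prediction C A J \<theta> j \<omega>) / real J"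

definition pivot_estimator ::
    "real \<Rightarrow> 'a crowd_model \<Rightarrow> nat set \<Rightarrow> nat \<Rightarrow> real \<Rightarrow> 'a \<Rightarrow> real" where
  "pivot_estimator \<psi> C A J \<theta> \<omega> =
     mean_prediction C A J \<theta> \<omega> +
       \<psi> * (mean_prediction C A J \<theta> \<omega> - mean_peer_prediction C A J \<theta> \<omega>)"

definition mse :: "'a crowd_model \<Rightarrow> (real \<Rightarrow> 'a \<Rightarrow> real) \<Rightarrow> real" where
  "mse C est = (\<integral>\<theta>. (\<integral>\<omega>. (est \<theta> \<omega> - \<theta>)\<^sup>2 \<partial>cond C \<theta>) \<partial>prior C)"

end

theory Submission
  imports Defs
begin

text \<open>
  Put \<open>q = p\<^sub>J w\<close>, with \<open>p\<^sub>J\<close> the proportion of mavens in a crowd of size \<open>J\<close>. The error of the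
  estimator splits as \<open>D(\<psi>) - \<theta> = (1 - q) (1 - \<psi> q) (s - \<theta>) + R\<close>, where \<open>R\<close> averages the private
  signals and the individual errors, so that \<open>E R\<^sup>2 = O(1/J)\<close>. Observations and errors need not be
  independent of each other: by AM-GM the cross term is \<open>O(1/\<surd>J)\<close>, with a constant that is
  integrable over the prior. Hence the mean squared error tends to
  \<open>(1 - pw)\<^sup>2 (1 - \<psi>pw)\<^sup>2 V\<close>, where \<open>V > 0\<close> is the mean of \<open>(s - \<theta>)\<^sup>2\<close>, and the comparison
  with \<open>\<psi> = 0\<close> comes down to \<open>\<bar>1 - \<psi>q\<bar> \<le> 1\<close> for all \<open>q \<in> [0, 1)\<close>.
\<close>

section \<open>Second-moment estimates and sums of independent variables\<close>

lemma power2_add_le: "(a + b)\<^sup>2 \<le> 2 * a\<^sup>2 + 2 * (b::real)\<^sup>2"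
  using sum_squares_bound[of a b] by (simp add: power2_sum)

lemma integrable_square_add:
  fixes f g :: "'a \<Rightarrow> real"
  assumes [measurable]: "f \<in> borel_measurable M" "g \<in> borel_measurable M"
    and "integrable M (\<lambda>x. (f x)\<^sup>2)" "integrable M (\<lambda>x. (g x)\<^sup>2)"
  shows "integrable M (\<lambda>x. (f x + g x)\<^sup>2)"
proof (rule Bochner_Integration.integrable_bound)
  show "integrable M (\<lambda>x. 2 * (f x)\<^sup>2 + 2 * (g x)\<^sup>2)"
    using assms by simp
  show "AE x in M. norm ((f x + g x)\<^sup>2) \<le> norm (2 * (f x)\<^sup>2 + 2 * (g x)\<^sup>2)"
    using power2_add_le by (simp add: abs_of_nonneg)
qed measurable

lemma integrable_square_mult:
  fixes f :: "'a \<Rightarrow> real"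
  assumes "integrable M (\<lambda>x. (f x)\<^sup>2)"
  shows "integrable M (\<lambda>x. (c * f x)\<^sup>2)"
  using assms by (simp add: power_mult_distrib)

text \<open>Expanding the square leaves a cross term \<open>2 * c * S * R\<close>, which weighted
  AM-GM bounds for any dependence between \<open>S\<close> and \<open>R\<close>. The parameter
  \<open>t\<close> stays free: a small \<open>t\<close> protects the main term at the price of the
  factor \<open>1 / t\<close> on the small remainder.\<close>

lemma second_moment_perturbation:
  fixes S R :: "'a \<Rightarrow> real"
  assumes [measurable]: "S \<in> borel_measurable M" "R \<in> borel_measurable M"
    and S: "integrable M (\<lambda>x. (S x)\<^sup>2)" and R: "integrable M (\<lambda>x. (R x)\<^sup>2)" and t: "t > 0"
  shows "\<bar>(\<integral>x. (c * S x + R x)\<^sup>2 \<partial>M) - c\<^sup>2 * (\<integral>x. (S x)\<^sup>2 \<partial>M)\<bar>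
           \<le> t * c\<^sup>2 * (\<integral>x. (S x)\<^sup>2 \<partial>M) + (1 / t + 1) * (\<integral>x. (R x)\<^sup>2 \<partial>M)"
proof -
  let ?D = "\<lambda>x. (c * S x + R x)\<^sup>2 - c\<^sup>2 * (S x)\<^sup>2"
  let ?B = "\<lambda>x. t * c\<^sup>2 * (S x)\<^sup>2 + (1 / t + 1) * (R x)\<^sup>2"
  have cS: "integrable M (\<lambda>x. (c * S x + R x)\<^sup>2)"
    by (intro integrable_square_add integrable_square_mult S R) measurable
  have "\<bar>?D x\<bar> \<le> ?B x" for x
  proof -
    have *: "2 * (c * S x) * R x \<le> t * c\<^sup>2 * (S x)\<^sup>2 + (R x)\<^sup>2 / t"
      "- (2 * (c * S x) * R x) \<le> t * c\<^sup>2 * (S x)\<^sup>2 + (R x)\<^sup>2 / t"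
    proof -
      \<comment> \<open>Both signs of the cross term come from expanding a square divided by
        \<open>t\<close>; this gives in fact \<open>t * c^2 * S^2 + R^2 / t\<close> as a bound for
        twice the product.\<close>
      have "0 \<le> (t * (c * S x) - R x)\<^sup>2 / t" "0 \<le> (t * (c * S x) + R x)\<^sup>2 / t"
        using t by simp_all
      then show "2 * (c * S x) * R x \<le> t * c\<^sup>2 * (S x)\<^sup>2 + (R x)\<^sup>2 / t"
        "- (2 * (c * S x) * R x) \<le> t * c\<^sup>2 * (S x)\<^sup>2 + (R x)\<^sup>2 / t"
        using t by (simp_all add: power2_eq_square field_simps)
    qed
    have "?D x = 2 * (c * S x) * R x + (R x)\<^sup>2"
      by (simp add: power2_eq_square algebra_simps)
    moreover have "?B x = t * c\<^sup>2 * (S x)\<^sup>2 + (R x)\<^sup>2 / t + (R x)\<^sup>2"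
      by (simp add: algebra_simps)
    moreover have "0 \<le> (R x)\<^sup>2" by simp
    ultimately show ?thesis using * by linarith
  qed
  then have "\<bar>\<integral>x. ?D x \<partial>M\<bar> \<le> (\<integral>x. ?B x \<partial>M)"
    using cS S R by (intro order_trans[OF integral_abs_bound] integral_mono) auto
  then show ?thesis
    using cS S R by simp
qed

text \<open>In the expanded double sum the off-diagonal products have expectation zero, by
  independence and centering, so only the diagonal survives.\<close>

lemma (in prob_space) indep_vars_sum_square:
  fixes Z :: "'i \<Rightarrow> 'a \<Rightarrow> real"
  assumes indep: "indep_vars (\<lambda>_. borel) Z I" and F: "finite F" "F \<subseteq> I"
    and sq: "\<And>i. i \<in> F \<Longrightarrow> integrable M (\<lambda>x. (Z i x)\<^sup>2)"
    and mean: "\<And>i. i \<in> F \<Longrightarrow> expectation (Z i) = 0"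
  shows "integrable M (\<lambda>x. (\<Sum>i\<in>F. Z i x)\<^sup>2)"
    and "expectation (\<lambda>x. (\<Sum>i\<in>F. Z i x)\<^sup>2) = (\<Sum>i\<in>F. expectation (\<lambda>x. (Z i x)\<^sup>2))"
proof -
  have meas: "Z i \<in> borel_measurable M" if "i \<in> F" for i
    using indep F that by (auto simp: indep_vars_def)
  have int: "integrable M (Z i)" if "i \<in> F" for i
    using square_integrable_imp_integrable[OF meas sq] that by auto
  have *: "integrable M (\<lambda>x. Z i x * Z j x) \<and>
      expectation (\<lambda>x. Z i x * Z j x) = (if i = j then expectation (\<lambda>x. (Z i x)\<^sup>2) else 0)"
    if "i \<in> F" "j \<in> F" for i j
  proof (cases "i = j")
    case True
    then show ?thesis using sq that by (simp add: power2_eq_square)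
  next
    case False
    have "indep_vars (\<lambda>_. borel) Z {i, j}"
      using indep F that by (intro indep_vars_subset[OF indep]) auto
    then show ?thesis
      using indep_vars_lebesgue_integral[of "{i, j}" Z] indep_vars_integrable[of "{i, j}" Z]
        False int mean that by auto
  qed
  have eq: "(\<Sum>i\<in>F. Z i x)\<^sup>2 = (\<Sum>i\<in>F. \<Sum>j\<in>F. Z i x * Z j x)" for x
    by (simp add: power2_eq_square sum_product)
  show "integrable M (\<lambda>x. (\<Sum>i\<in>F. Z i x)\<^sup>2)"
    unfolding eq using * by (intro Bochner_Integration.integrable_sum) auto
  show "expectation (\<lambda>x. (\<Sum>i\<in>F. Z i x)\<^sup>2) = (\<Sum>i\<in>F. expectation (\<lambda>x. (Z i x)\<^sup>2))"
    unfolding eq using * F(1)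
    by (subst Bochner_Integration.integral_sum, force intro!: Bochner_Integration.integrable_sum)
       (auto intro!: sum.cong simp: Bochner_Integration.integral_sum)
qed

text \<open>Centering preserves independence, and every moment can be read off the common law \<nu>,
  so each summand contributes the variance of \<nu>.\<close>

lemma (in prob_space) indep_identically_distributed_sum_square:
  fixes Z :: "'i \<Rightarrow> 'a \<Rightarrow> real"
  assumes indep: "indep_vars (\<lambda>_. borel) Z I" and F: "finite F" "F \<subseteq> I"
    and distr: "\<And>i. i \<in> F \<Longrightarrow> distr M borel (Z i) = \<nu>"
    and sq: "integrable \<nu> (\<lambda>x. x\<^sup>2)" and mean: "(\<integral>x. x \<partial>\<nu>) = m"
  shows "integrable M (\<lambda>x. (\<Sum>i\<in>F. Z i x - m)\<^sup>2)"
    and "expectation (\<lambda>x. (\<Sum>i\<in>F. Z i x - m)\<^sup>2) = real (card F) * (\<integral>x. (x - m)\<^sup>2 \<partial>\<nu>)"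
proof -
  have meas [measurable]: "Z i \<in> borel_measurable M" if "i \<in> F" for i
    using indep F that by (auto simp: indep_vars_def)
  have indep': "indep_vars (\<lambda>_. borel) (\<lambda>i x. Z i x - m) I"
    by (rule indep_vars_compose2[OF indep]) simp
  have sq': "integrable M (\<lambda>x. (Z i x - m)\<^sup>2)" if i: "i \<in> F" for i
  proof -
    have "integrable M (\<lambda>x. (Z i x)\<^sup>2)"
      using sq meas[OF i] by (simp flip: distr[OF i] add: integrable_distr_eq)
    then show ?thesis
      using integrable_square_add[of "Z i" M "\<lambda>_. - m"] meas[OF i] by simp
  qed
  have mean': "expectation (\<lambda>x. Z i x - m) = 0" if i: "i \<in> F" for i
  proof -
    have 1: "integrable M (\<lambda>x. (Z i x)\<^sup>2)"
      using sq meas[OF i] by (simp flip: distr[OF i] add: integrable_distr_eq)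
    have "expectation (Z i) = m"
      using mean meas[OF i] by (simp flip: distr[OF i] add: integral_distr)
    then show ?thesis
      using square_integrable_imp_integrable[OF meas[OF i] 1] by (simp add: prob_space)
  qed
  have var: "expectation (\<lambda>x. (Z i x - m)\<^sup>2) = (\<integral>x. (x - m)\<^sup>2 \<partial>\<nu>)" if i: "i \<in> F" for i
    using meas[OF i] by (simp flip: distr[OF i] add: integral_distr)
  show "integrable M (\<lambda>x. (\<Sum>i\<in>F. Z i x - m)\<^sup>2)"
    by (rule indep_vars_sum_square(1)[OF indep' F sq' mean'])
  show "expectation (\<lambda>x. (\<Sum>i\<in>F. Z i x - m)\<^sup>2) = real (card F) * (\<integral>x. (x - m)\<^sup>2 \<partial>\<nu>)"
    by (subst indep_vars_sum_square(2)[OF indep' F sq' mean']) (auto simp: var)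
qed

subsection \<open>The model given the mean\<close>

text \<open>This is the mean squared error of the shared information given \<theta>: the squared
  bias caused by the prior mean plus the sampling variance of the public signal.\<close>

definition shared_variance :: "'a crowd_model \<Rightarrow> real \<Rightarrow> real" where
  "shared_variance C \<theta> =
     ((n_prior C * (prior_mean C - \<theta>))\<^sup>2 + real (n_public C) * X_variance C \<theta>) / (n_shared C)\<^sup>2"

text \<open>A common majorant for all individual noise: once weights are bounded by 1 and numbers of
  judges by \<open>J\<close>, the four noise sums together have second moment at most
  \<open>J\<close> times this.\<close>

definition noise_variance :: "'a crowd_model \<Rightarrow> real \<Rightarrow> real" where
  "noise_variance C \<theta> = X_variance C \<theta> + (\<integral>x. x\<^sup>2 \<partial>err_law C Delta)
     + (\<integral>x. x\<^sup>2 \<partial>err_law C Epsilon) + (\<integral>x. x\<^sup>2 \<partial>err_law C Gamma)"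

lemma X_variance_nonneg: "X_variance C \<theta> \<ge> 0"
  by (simp add: X_variance_def)

lemma shared_variance_nonneg: "shared_variance C \<theta> \<ge> 0"
  by (simp add: shared_variance_def X_variance_nonneg)

lemma noise_variance_nonneg: "noise_variance C \<theta> \<ge> 0"
  by (simp add: noise_variance_def X_variance_nonneg)

text \<open>The coefficient of \<open>s - \<theta>\<close> in the estimation error: the mean reports
  carry \<open>1 - q\<close> and \<open>1 - q^2\<close>, and
  \<open>(1 + \<psi>) * (1 - q) - \<psi> * (1 - q^2)\<close> factors in this way.\<close>

definition limit_factor :: "real \<Rightarrow> real \<Rightarrow> real" where
  "limit_factor \<psi> q = (1 - q) * (1 - \<psi> * q)"

text \<open>Uniformity in \<open>q\<close> matters: the proportion of mavens varies with
  \<open>J\<close>, while the constant in the error bound must not.\<close>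

lemma limit_factor_bound:
  assumes "0 \<le> \<psi>" "0 \<le> q" "q \<le> 1"
  shows "(limit_factor \<psi> q)\<^sup>2 \<le> (1 + \<psi>)\<^sup>2"
proof -
  have "\<bar>1 - \<psi> * q\<bar> \<le> 1 + \<psi>"
    using assms mult_left_le[of q \<psi>] by (simp add: abs_le_iff) (smt (verit) mult_nonneg_nonneg)
  then have "\<bar>1 - q\<bar> * \<bar>1 - \<psi> * q\<bar> \<le> 1 * (1 + \<psi>)"
    using assms by (intro mult_mono) auto
  then show ?thesis
    using assms unfolding limit_factor_def
    by (metis abs_mult abs_le_square_iff abs_of_nonneg mult_1 add_nonneg_nonneg zero_le_one)
qed

text \<open>The conditional clauses of the model hold for almost every \<theta> only; they are
  collected here for one such \<theta>. Bounds are kept explicit in \<theta>, since they are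
  integrated over the prior afterwards.\<close>

locale conditional_crowd = prob_space "cond C \<theta>" for C :: "'a crowd_model" and \<theta> :: real +
  assumes X_square: "integrable (X_law C \<theta>) (\<lambda>x. x\<^sup>2)" and X_mean: "(\<integral>x. x \<partial>X_law C \<theta>) = \<theta>"
    and indep_obs: "indep_vars (\<lambda>_. borel) (case_sum (pub_obs C) (case_prod (priv_obs C))) UNIV"
    and distr_pub: "\<And>i. distr (cond C \<theta>) borel (pub_obs C i) = X_law C \<theta>"
    and distr_priv: "\<And>j i. distr (cond C \<theta>) borel (priv_obs C j i) = X_law C \<theta>"
    and indep_err: "indep_vars (\<lambda>_. borel) (case_prod (err C)) UNIV"
    and distr_err: "\<And>k j. distr (cond C \<theta>) borel (err C k j) = err_law C k"
    and err_square: "\<And>k. integrable (err_law C k) (\<lambda>x. x\<^sup>2)"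
    and err_mean: "\<And>k. (\<integral>x. x \<partial>err_law C k) = 0"
    and n_shared_pos: "0 < n_shared C"
begin

lemma measurable_pub [measurable]: "pub_obs C i \<in> borel_measurable (cond C \<theta>)"
  using indep_obs unfolding indep_vars_def by (auto dest!: spec[of _ "Inl i"])

lemma measurable_priv [measurable]: "priv_obs C j i \<in> borel_measurable (cond C \<theta>)"
  using indep_obs unfolding indep_vars_def by (auto dest!: spec[of _ "Inr (j, i)"])

lemma measurable_err [measurable]: "err C k j \<in> borel_measurable (cond C \<theta>)"
  using indep_err unfolding indep_vars_def by (auto dest!: spec[of _ "(k, j)"])

lemma obs_sum_square:
  assumes "finite F"
  shows "integrable (cond C \<theta>)
           (\<lambda>\<omega>. (\<Sum>i\<in>F. case_sum (pub_obs C) (case_prod (priv_obs C)) i \<omega> - \<theta>)\<^sup>2)"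
    and "expectation (\<lambda>\<omega>. (\<Sum>i\<in>F. case_sum (pub_obs C) (case_prod (priv_obs C)) i \<omega> - \<theta>)\<^sup>2)
           = real (card F) * X_variance C \<theta>"
  unfolding X_variance_def
  by (rule indep_identically_distributed_sum_square[OF indep_obs assms subset_UNIV _ X_square X_mean];
      auto simp: distr_pub distr_priv split: sum.split)+

lemma pub_sum_square:
  "integrable (cond C \<theta>) (\<lambda>\<omega>. (\<Sum>i<n. pub_obs C i \<omega> - \<theta>)\<^sup>2)"
  "expectation (\<lambda>\<omega>. (\<Sum>i<n. pub_obs C i \<omega> - \<theta>)\<^sup>2) = real n * X_variance C \<theta>"
  using obs_sum_square[of "Inl ` {..<n}"] by (simp_all add: sum.reindex card_image)

text \<open>The observations of different mavens are treated as a single independent family indexed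
  by pairs of judge and observation, so one variance count covers the double sum.\<close>

lemma priv_sum_square:
  assumes "finite A"
  shows "integrable (cond C \<theta>) (\<lambda>\<omega>. (\<Sum>j\<in>A. \<Sum>i<l. priv_obs C j i \<omega> - \<theta>)\<^sup>2)"
    and "expectation (\<lambda>\<omega>. (\<Sum>j\<in>A. \<Sum>i<l. priv_obs C j i \<omega> - \<theta>)\<^sup>2)
           = real (card A * l) * X_variance C \<theta>"
  using obs_sum_square[of "Inr ` (A \<times> {..<l})"] assms
  by (simp_all add: sum.reindex card_image sum.cartesian_product card_cartesian_product
      case_prod_unfold)

lemma err_sum_square:
  assumes "finite A"
  shows "integrable (cond C \<theta>) (\<lambda>\<omega>. (\<Sum>j\<in>A. err C k j \<omega>)\<^sup>2)"
    and "expectation (\<lambda>\<omega>. (\<Sum>j\<in>A. err C k j \<omega>)\<^sup>2) = real (card A) * (\<integral>x. x\<^sup>2 \<partial>err_law C k)"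
proof -
  have inj: "inj_on (Pair k) A" by (auto simp: inj_on_def)
  have *: "finite (Pair k ` A)" using assms by simp
  have d: "distr (cond C \<theta>) borel (case_prod (err C) i) = err_law C k" if "i \<in> Pair k ` A" for i
    using that distr_err by auto
  note res = indep_identically_distributed_sum_square
    [OF indep_err * subset_UNIV d err_square err_mean]
  show "integrable (cond C \<theta>) (\<lambda>\<omega>. (\<Sum>j\<in>A. err C k j \<omega>)\<^sup>2)"
    using res(1) inj by (simp add: sum.reindex)
  show "expectation (\<lambda>\<omega>. (\<Sum>j\<in>A. err C k j \<omega>)\<^sup>2) = real (card A) * (\<integral>x. x\<^sup>2 \<partial>err_law C k)"
    using res(2) inj by (simp add: sum.reindex card_image)
qed

lemma measurable_shared [measurable]: "shared_info C \<in> borel_measurable (cond C \<theta>)"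
  unfolding shared_info_def[abs_def] sample_mean_def by measurable

lemma measurable_private [measurable]: "private_signal C \<theta> j \<in> borel_measurable (cond C \<theta>)"
  unfolding private_signal_def[abs_def] sample_mean_def by (cases "n_private C") simp_all

text \<open>The deviation is a constant bias plus a centered sum of public observations, so the
  mixed term has expectation zero.\<close>

lemma shared_info_square:
  "integrable (cond C \<theta>) (\<lambda>\<omega>. (shared_info C \<omega> - \<theta>)\<^sup>2)"
  "expectation (\<lambda>\<omega>. (shared_info C \<omega> - \<theta>)\<^sup>2) = shared_variance C \<theta>"
proof -
  let ?n = "n_public C" and ?m = "n_shared C"
  let ?Y = "\<lambda>\<omega>. \<Sum>i<?n. pub_obs C i \<omega> - \<theta>"
  let ?b = "n_prior C * (prior_mean C - \<theta>)"
  have eq: "shared_info C \<omega> - \<theta> = (?b + ?Y \<omega>) / ?m" for \<omega>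
  proof -
    \<comment> \<open>This also holds without public observations: \<open>sample_mean\<close> then
      divides by zero and is 0, and the sum is empty.\<close>
    have "real ?n * sample_mean ?n (pub_obs C) \<omega> = (\<Sum>i<?n. pub_obs C i \<omega>)"
      by (simp add: sample_mean_def)
    then show ?thesis
      using n_shared_pos unfolding shared_info_def
      by (simp add: sum_subtractf field_simps) (simp add: n_shared_def algebra_simps)
  qed
  have Y: "integrable (cond C \<theta>) ?Y" "expectation ?Y = 0"
  proof -
    have 1: "integrable (cond C \<theta>) (pub_obs C i) \<and> expectation (pub_obs C i) = \<theta>" for i
    proof -
      have "integrable (cond C \<theta>) (\<lambda>\<omega>. (pub_obs C i \<omega>)\<^sup>2)"
        using X_square by (simp flip: distr_pub[of i] add: integrable_distr_eq)
      then have "integrable (cond C \<theta>) (pub_obs C i)"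
        by (rule square_integrable_imp_integrable[rotated]) simp
      moreover have "expectation (pub_obs C i) = \<theta>"
        using X_mean by (subst (asm) distr_pub[of i, symmetric]) (simp add: integral_distr)
      ultimately show ?thesis by simp
    qed
    then show "integrable (cond C \<theta>) ?Y" by auto
    from 1 show "expectation ?Y = 0"
      by (subst Bochner_Integration.integral_sum) (auto simp: prob_space)
  qed
  have sq: "(shared_info C \<omega> - \<theta>)\<^sup>2 = (?b\<^sup>2 + 2 * ?b * ?Y \<omega> + (?Y \<omega>)\<^sup>2) / ?m\<^sup>2" for \<omega>
    unfolding eq by (simp only: power_divide power2_sum) (simp add: algebra_simps)
  note int = Y(1) pub_sum_square(1)[of ?n]
  show "integrable (cond C \<theta>) (\<lambda>\<omega>. (shared_info C \<omega> - \<theta>)\<^sup>2)"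
    unfolding sq using int
    by (intro integrable_divide_zero Bochner_Integration.integrable_add integrable_mult_right) auto
  show "expectation (\<lambda>\<omega>. (shared_info C \<omega> - \<theta>)\<^sup>2) = shared_variance C \<theta>"
    unfolding sq shared_variance_def using int
    by (simp add: pub_sum_square(2) Y(2) prob_space)
qed

text \<open>The bound is uniform in the number \<open>l\<close> of private observations: a mean of
  \<open>l\<close> observations has variance \<open>X_variance C \<theta> / l\<close>, and the
  squared weight is at most 1.\<close>

lemma private_signal_sum_square:
  assumes "finite A"
  shows "integrable (cond C \<theta>)
           (\<lambda>\<omega>. (\<Sum>j\<in>A. private_weight C * (private_signal C \<theta> j \<omega> - \<theta>))\<^sup>2)"
    and "expectation (\<lambda>\<omega>. (\<Sum>j\<in>A. private_weight C * (private_signal C \<theta> j \<omega> - \<theta>))\<^sup>2)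
           \<le> real (card A) * X_variance C \<theta>"
proof -
  let ?W = "\<lambda>\<omega>. \<Sum>j\<in>A. private_weight C * (private_signal C \<theta> j \<omega> - \<theta>)"
  have "integrable (cond C \<theta>) (\<lambda>\<omega>. (?W \<omega>)\<^sup>2) \<and>
      expectation (\<lambda>\<omega>. (?W \<omega>)\<^sup>2) \<le> real (card A) * X_variance C \<theta>"
  proof (cases "private_weight C = 0 \<or> n_private C = \<infinity>")
    case True
    \<comment> \<open>Either the weight vanishes, or the private signal is \<theta> itself. In
      particular \<open>l = 0\<close> falls under this case.\<close>
    then have "?W \<omega> = 0" for \<omega>
      by (auto simp: private_signal_def)
    then show ?thesis
      by (simp add: X_variance_nonneg)
  next
    case False
    then obtain l where l: "n_private C = enat l" by auto
    then have w: "private_weight C = real l / (real l + n_shared C)"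
      by (simp add: private_weight_def)
    with False have l0: "l > 0" by (cases l) auto
    have w1: "0 \<le> private_weight C" "private_weight C \<le> 1"
      using n_shared_pos l0 by (simp_all add: w)
    let ?c = "private_weight C / real l"
    have "?W \<omega> = ?c * (\<Sum>j\<in>A. \<Sum>i<l. priv_obs C j i \<omega> - \<theta>)" for \<omega>
    proof -
      have "private_signal C \<theta> j \<omega> - \<theta> = (\<Sum>i<l. priv_obs C j i \<omega> - \<theta>) / real l" for j
        using l0 by (simp add: private_signal_def l sample_mean_def sum_subtractf field_simps)
      then show ?thesis
        by (simp add: sum_distrib_left sum_divide_distrib)
    qed
    then have W: "(?W \<omega>)\<^sup>2 = ?c\<^sup>2 * (\<Sum>j\<in>A. \<Sum>i<l. priv_obs C j i \<omega> - \<theta>)\<^sup>2" for \<omega>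
      by (simp add: power_mult_distrib power_divide)
    have "expectation (\<lambda>\<omega>. (?W \<omega>)\<^sup>2) = ?c\<^sup>2 * real l * (real (card A) * X_variance C \<theta>)"
      unfolding W by (simp add: priv_sum_square(2)[OF assms])
    also have "\<dots> \<le> 1 * (real (card A) * X_variance C \<theta>)"
    proof (rule mult_right_mono)
      have "?c\<^sup>2 * real l = (private_weight C)\<^sup>2 / real l"
        using l0 by (simp add: power2_eq_square)
      also have "\<dots> \<le> 1 / 1"
        using w1 l0 by (intro frac_le) (auto simp: power_le_one)
      finally show "?c\<^sup>2 * real l \<le> 1" by simp
    qed (simp add: X_variance_nonneg)
    finally show ?thesis
      unfolding W using priv_sum_square(1)[OF assms] by simp
  qed
  then show "integrable (cond C \<theta>) (\<lambda>\<omega>. (?W \<omega>)\<^sup>2)"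
    "expectation (\<lambda>\<omega>. (?W \<omega>)\<^sup>2) \<le> real (card A) * X_variance C \<theta>"
    by auto
qed

section \<open>Decomposition of the mean reports and the conditional error bound\<close>

text \<open>With \<open>p\<close> the proportion of mavens, averaging the weights on the shared
  information gives \<open>p * (1 - w) + (1 - p) = 1 - q\<close> and
  \<open>p * (1 - p * w^2) + (1 - p) = 1 - q^2\<close>. Peer predictions repeat the noise
  \<open>W\<close> and \<open>Epsilon\<close> of the predictions, damped by
  \<open>q\<close>.\<close>

lemma mean_prediction_eq:
  assumes A: "A \<subseteq> {..<J}" and J: "J > 0"
  defines "q \<equiv> maven_proportion A J * private_weight C"
  defines "W \<equiv> \<lambda>\<omega>. \<Sum>j\<in>A. private_weight C * (private_signal C \<theta> j \<omega> - \<theta>)"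
  shows "mean_prediction C A J \<theta> \<omega> - \<theta> = (1 - q) * (shared_info C \<omega> - \<theta>)
      + (W \<omega> + (\<Sum>j\<in>A. err C Epsilon j \<omega>) - (\<Sum>j\<in>{..<J} - A. err C Delta j \<omega>)) / real J"
    and "mean_peer_prediction C A J \<theta> \<omega> - \<theta> = (1 - q\<^sup>2) * (shared_info C \<omega> - \<theta>)
      + (q * (W \<omega> + (\<Sum>j\<in>A. err C Epsilon j \<omega>)) + (\<Sum>j\<in>A. err C Gamma j \<omega>)
         - (\<Sum>j\<in>{..<J} - A. err C Delta j \<omega>)) / real J"
proof -
  let ?s = "shared_info C \<omega> - \<theta>" and ?w = "private_weight C" and ?p = "maven_proportion A J"
  let ?E = "\<Sum>j\<in>A. err C Epsilon j \<omega>" and ?G = "\<Sum>j\<in>A. err C Gamma j \<omega>"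
    and ?D = "\<Sum>j\<in>{..<J} - A. err C Delta j \<omega>"
  have fin: "finite A" using A finite_subset by blast
  have split: "(\<Sum>j<J. f j) = (\<Sum>j\<in>A. f j) + (\<Sum>j\<in>{..<J} - A. f j)" for f :: "nat \<Rightarrow> real"
    using sum.subset_diff[OF A, of f] by simp
  have cA: "real (card A) = ?p * real J"
    using J by (simp add: maven_proportion_def)
  have cB: "real (card ({..<J} - A)) = (1 - ?p) * real J"
    using A fin J card_mono[OF _ A] by (simp add: card_Diff_subset of_nat_diff cA algebra_simps)
  have "(\<Sum>j<J. prediction C A \<theta> j \<omega> - \<theta>)
      = (\<Sum>j\<in>A. (1 - ?w) * ?s + ?w * (private_signal C \<theta> j \<omega> - \<theta>) + err C Epsilon j \<omega>)
        + (\<Sum>j\<in>{..<J} - A. ?s - err C Delta j \<omega>)"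
    unfolding split by (intro arg_cong2[where f = "(+)"] sum.cong)
      (auto simp: prediction_def Let_def algebra_simps)
  also have "\<dots> = real (card A) * ((1 - ?w) * ?s) + W \<omega> + ?E + real (card ({..<J} - A)) * ?s - ?D"
    by (simp add: W_def sum.distrib sum_subtractf)
  also have "\<dots> = real J * ((1 - q) * ?s) + (W \<omega> + ?E - ?D)"
    by (simp add: cA cB q_def algebra_simps)
  finally show "mean_prediction C A J \<theta> \<omega> - \<theta> = (1 - q) * ?s + (W \<omega> + ?E - ?D) / real J"
    using J by (simp add: mean_prediction_def sum_subtractf field_simps)
  have "(\<Sum>j<J. peer_prediction C A J \<theta> j \<omega> - \<theta>)
      = (\<Sum>j\<in>A. (1 - ?p * ?w\<^sup>2) * ?s + q * (?w * (private_signal C \<theta> j \<omega> - \<theta>))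
            + q * err C Epsilon j \<omega> + err C Gamma j \<omega>)
        + (\<Sum>j\<in>{..<J} - A. ?s - err C Delta j \<omega>)"
    unfolding split by (intro arg_cong2[where f = "(+)"] sum.cong)
      (auto simp: peer_prediction_def Let_def q_def power2_eq_square algebra_simps)
  also have "\<dots> = real (card A) * ((1 - ?p * ?w\<^sup>2) * ?s) + q * (W \<omega> + ?E) + ?G
        + real (card ({..<J} - A)) * ?s - ?D"
    by (simp add: W_def sum.distrib sum_subtractf sum_distrib_left distrib_left)
  also have "\<dots> = real J * ((1 - q\<^sup>2) * ?s) + (q * (W \<omega> + ?E) + ?G - ?D)"
    by (simp add: cA cB q_def power2_eq_square algebra_simps)
  finally show "mean_peer_prediction C A J \<theta> \<omega> - \<theta>
      = (1 - q\<^sup>2) * ?s + (q * (W \<omega> + ?E) + ?G - ?D) / real J"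
    using J by (simp add: mean_peer_prediction_def sum_subtractf field_simps)
qed

text \<open>The remainder \<open>R\<close> has second moment of order \<open>1 / J\<close>, and
  \<open>second_moment_perturbation\<close> turns this into an error of order
  \<open>1 / sqrt J\<close>.\<close>

lemma conditional_mse_bound:
  assumes A: "A \<subseteq> {..<J}" and J: "J > 0" and \<psi>: "\<psi> \<ge> 0" and w: "private_weight C \<in> {0..1}"
  shows "\<bar>expectation (\<lambda>\<omega>. (pivot_estimator \<psi> C A J \<theta> \<omega> - \<theta>)\<^sup>2)
       - (limit_factor \<psi> (maven_proportion A J * private_weight C))\<^sup>2 * shared_variance C \<theta>\<bar>
     \<le> (1 + \<psi>)\<^sup>2 * (shared_variance C \<theta> + 8 * noise_variance C \<theta>) / sqrt (real J)"
proof -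
  define p where "p = maven_proportion A J"
  define q where "q = p * private_weight C"
  \<comment> \<open>The coefficient of \<open>W + E\<close> in the estimator:
    \<open>1 + \<psi>\<close> from the mean prediction minus \<open>\<psi> * q\<close> from the mean
    peer prediction.\<close>
  define a where "a = 1 + \<psi> * (1 - q)"
  define W where "W = (\<lambda>\<omega>. \<Sum>j\<in>A. private_weight C * (private_signal C \<theta> j \<omega> - \<theta>))"
  define E where "E = (\<lambda>\<omega>. \<Sum>j\<in>A. err C Epsilon j \<omega>)"
  define G where "G = (\<lambda>\<omega>. \<Sum>j\<in>A. err C Gamma j \<omega>)"
  define D where "D = (\<lambda>\<omega>. \<Sum>j\<in>{..<J} - A. err C Delta j \<omega>)"
  define R where "R = (\<lambda>\<omega>. (a * (W \<omega> + E \<omega>) - \<psi> * G \<omega> - D \<omega>) / real J)"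
  define S where "S = (\<lambda>\<omega>. shared_info C \<omega> - \<theta>)"
  have [measurable]: "W \<in> borel_measurable (cond C \<theta>)" "E \<in> borel_measurable (cond C \<theta>)"
    "G \<in> borel_measurable (cond C \<theta>)" "D \<in> borel_measurable (cond C \<theta>)"
    "R \<in> borel_measurable (cond C \<theta>)" "S \<in> borel_measurable (cond C \<theta>)"
    unfolding R_def W_def E_def G_def D_def S_def by measurable
  have fin: "finite A" "finite ({..<J} - A)" using A finite_subset by auto
  have card: "real (card A) \<le> real J" "real (card ({..<J} - A)) \<le> real J"
    using card_mono[OF _ A] card_mono[of "{..<J}" "{..<J} - A"] by auto
  have p: "0 \<le> p" "p \<le> 1"
    using card J by (simp_all add: p_def maven_proportion_def)
  have q: "0 \<le> q" "q \<le> 1"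
    using p w by (auto simp: q_def intro: mult_le_one)
  have "0 \<le> \<psi> * (1 - q)" "\<psi> * (1 - q) \<le> \<psi>"
    using \<psi> q by (simp_all add: mult_left_le)
  then have a: "0 \<le> a" "a \<le> 1 + \<psi>" by (simp_all add: a_def)
  have K: "a\<^sup>2 \<le> (1 + \<psi>)\<^sup>2" "\<psi>\<^sup>2 \<le> (1 + \<psi>)\<^sup>2" "1 \<le> (1 + \<psi>)\<^sup>2"
    using a \<psi> by (auto intro: power_mono simp: one_le_power)
  have means: "mean_prediction C A J \<theta> \<omega> - \<theta> = (1 - q) * S \<omega> + (W \<omega> + E \<omega> - D \<omega>) / real J"
    "mean_peer_prediction C A J \<theta> \<omega> - \<theta>
      = (1 - q\<^sup>2) * S \<omega> + (q * (W \<omega> + E \<omega>) + G \<omega> - D \<omega>) / real J" for \<omega>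
    unfolding q_def p_def S_def W_def E_def G_def D_def by (rule mean_prediction_eq[OF A J])+
  have decomp: "pivot_estimator \<psi> C A J \<theta> \<omega> - \<theta> = limit_factor \<psi> q * S \<omega> + R \<omega>" for \<omega>
  proof -
    have "pivot_estimator \<psi> C A J \<theta> \<omega> - \<theta> = (1 + \<psi>) * (mean_prediction C A J \<theta> \<omega> - \<theta>)
        - \<psi> * (mean_peer_prediction C A J \<theta> \<omega> - \<theta>)"
      by (simp add: pivot_estimator_def algebra_simps)
    also have "\<dots> = limit_factor \<psi> q * S \<omega> + R \<omega>"
      unfolding means R_def limit_factor_def a_def
      using J by (simp add: field_simps power2_eq_square)
    finally show ?thesis .
  qed
  have int: "integrable (cond C \<theta>) (\<lambda>\<omega>. (W \<omega>)\<^sup>2)" "integrable (cond C \<theta>) (\<lambda>\<omega>. (E \<omega>)\<^sup>2)"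
    "integrable (cond C \<theta>) (\<lambda>\<omega>. (G \<omega>)\<^sup>2)" "integrable (cond C \<theta>) (\<lambda>\<omega>. (D \<omega>)\<^sup>2)"
    "integrable (cond C \<theta>) (\<lambda>\<omega>. (S \<omega>)\<^sup>2)"
    unfolding W_def E_def G_def D_def S_def
    by (rule private_signal_sum_square err_sum_square shared_info_square fin)+
  \<comment> \<open>Splitting four summands by two levels of \<open>power2_add_le\<close> costs the
    factor 4; \<open>(1 + \<psi>)^2\<close> dominates the squares of the coefficients
    \<open>a\<close>, \<psi> and 1.\<close>
  let ?B = "\<lambda>\<omega>. 4 * (1 + \<psi>)\<^sup>2 / (real J)\<^sup>2 * ((W \<omega>)\<^sup>2 + (E \<omega>)\<^sup>2 + (G \<omega>)\<^sup>2 + (D \<omega>)\<^sup>2)"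
  have intB: "integrable (cond C \<theta>) ?B"
    using int by (intro integrable_mult_right Bochner_Integration.integrable_add)
  have R_le: "(R \<omega>)\<^sup>2 \<le> ?B \<omega>" for \<omega>
  proof -
    have "(a * (W \<omega> + E \<omega>) - \<psi> * G \<omega> - D \<omega>)\<^sup>2
        = ((a * W \<omega> + a * E \<omega>) + (- \<psi> * G \<omega> + - D \<omega>))\<^sup>2"
      by (simp add: algebra_simps)
    also have "\<dots> \<le> 4 * (a\<^sup>2 * (W \<omega>)\<^sup>2 + a\<^sup>2 * (E \<omega>)\<^sup>2 + \<psi>\<^sup>2 * (G \<omega>)\<^sup>2 + 1 * (D \<omega>)\<^sup>2)"
      using power2_add_le[of "a * W \<omega> + a * E \<omega>" "- \<psi> * G \<omega> + - D \<omega>"]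
        power2_add_le[of "a * W \<omega>" "a * E \<omega>"] power2_add_le[of "- \<psi> * G \<omega>" "- D \<omega>"]
      by (simp add: power_mult_distrib)
    also have "\<dots> \<le> 4 * ((1 + \<psi>)\<^sup>2 * (W \<omega>)\<^sup>2 + (1 + \<psi>)\<^sup>2 * (E \<omega>)\<^sup>2
        + (1 + \<psi>)\<^sup>2 * (G \<omega>)\<^sup>2 + (1 + \<psi>)\<^sup>2 * (D \<omega>)\<^sup>2)"
      by (intro mult_left_mono add_mono mult_right_mono K) auto
    finally have "(R \<omega>)\<^sup>2 \<le> 4 * ((1 + \<psi>)\<^sup>2 * (W \<omega>)\<^sup>2 + (1 + \<psi>)\<^sup>2 * (E \<omega>)\<^sup>2
        + (1 + \<psi>)\<^sup>2 * (G \<omega>)\<^sup>2 + (1 + \<psi>)\<^sup>2 * (D \<omega>)\<^sup>2) / (real J)\<^sup>2"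
      by (simp add: R_def power_divide divide_right_mono)
    then show ?thesis by (simp add: algebra_simps add_divide_distrib)
  qed
  have intR: "integrable (cond C \<theta>) (\<lambda>\<omega>. (R \<omega>)\<^sup>2)"
    by (rule Bochner_Integration.integrable_bound[OF intB])
      (use R_le in \<open>auto intro: order_trans[OF _ abs_ge_self]\<close>)
  have "expectation (\<lambda>\<omega>. (R \<omega>)\<^sup>2) \<le> expectation ?B"
    by (intro integral_mono intR intB R_le)
  also have "\<dots> = 4 * (1 + \<psi>)\<^sup>2 / (real J)\<^sup>2 * (expectation (\<lambda>\<omega>. (W \<omega>)\<^sup>2)
      + expectation (\<lambda>\<omega>. (E \<omega>)\<^sup>2) + expectation (\<lambda>\<omega>. (G \<omega>)\<^sup>2) + expectation (\<lambda>\<omega>. (D \<omega>)\<^sup>2))"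
    using int by simp
  also have "\<dots> \<le> 4 * (1 + \<psi>)\<^sup>2 / (real J)\<^sup>2 * (real J * noise_variance C \<theta>)"
  proof (intro mult_left_mono)
    have "expectation (\<lambda>\<omega>. (W \<omega>)\<^sup>2) \<le> real J * X_variance C \<theta>"
      unfolding W_def using card X_variance_nonneg
      by (blast intro: order_trans[OF private_signal_sum_square(2)[OF fin(1)]] mult_right_mono)
    moreover have "expectation (\<lambda>\<omega>. (E \<omega>)\<^sup>2) \<le> real J * (\<integral>x. x\<^sup>2 \<partial>err_law C Epsilon)"
      "expectation (\<lambda>\<omega>. (G \<omega>)\<^sup>2) \<le> real J * (\<integral>x. x\<^sup>2 \<partial>err_law C Gamma)"
      "expectation (\<lambda>\<omega>. (D \<omega>)\<^sup>2) \<le> real J * (\<integral>x. x\<^sup>2 \<partial>err_law C Delta)"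
      unfolding E_def G_def D_def err_sum_square(2)[OF fin(1)] err_sum_square(2)[OF fin(2)]
      by (intro mult_right_mono card; simp)+
    ultimately show "expectation (\<lambda>\<omega>. (W \<omega>)\<^sup>2) + expectation (\<lambda>\<omega>. (E \<omega>)\<^sup>2)
        + expectation (\<lambda>\<omega>. (G \<omega>)\<^sup>2) + expectation (\<lambda>\<omega>. (D \<omega>)\<^sup>2) \<le> real J * noise_variance C \<theta>"
      by (simp add: noise_variance_def algebra_simps)
  qed simp
  finally have ER: "expectation (\<lambda>\<omega>. (R \<omega>)\<^sup>2) \<le> 4 * (1 + \<psi>)\<^sup>2 * noise_variance C \<theta> / real J"
    using J by (simp add: power2_eq_square)
  \<comment> \<open>This choice balances the two error terms, of orders \<open>t\<close> and
    \<open>1 / (t * J)\<close>. Since \<open>t * t \<le> t\<close>, the factor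
    \<open>1 / t + 1\<close> doubles the 4 to the final 8.\<close>
  define t where "t = 1 / sqrt (real J)"
  have t: "0 < t" "t \<le> 1" "1 / real J = t * t"
    using J by (simp_all add: t_def)
  define V where "V = shared_variance C \<theta>"
  define \<rho> where "\<rho> = noise_variance C \<theta>"
  define c where "c = limit_factor \<psi> q"
  have V: "expectation (\<lambda>\<omega>. (S \<omega>)\<^sup>2) = V" "V \<ge> 0"
    by (simp_all add: S_def V_def shared_info_square shared_variance_nonneg)
  have \<rho>: "\<rho> \<ge> 0" by (simp add: \<rho>_def noise_variance_nonneg)
  have "\<bar>expectation (\<lambda>\<omega>. (c * S \<omega> + R \<omega>)\<^sup>2) - c\<^sup>2 * V\<bar>
      \<le> t * c\<^sup>2 * V + (1 / t + 1) * expectation (\<lambda>\<omega>. (R \<omega>)\<^sup>2)"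
    using second_moment_perturbation[of S "cond C \<theta>" R t c] int(5) intR t(1) by (simp add: V(1))
  also have "\<dots> \<le> t * (1 + \<psi>)\<^sup>2 * V + (1 / t + 1) * (4 * (1 + \<psi>)\<^sup>2 * \<rho> * (t * t))"
    using limit_factor_bound[OF \<psi> q] t(1) V(2) ER t(3)
    by (intro add_mono mult_right_mono mult_left_mono) (auto simp: c_def \<rho>_def divide_inverse)
  also have "\<dots> = t * (1 + \<psi>)\<^sup>2 * V + 4 * (1 + \<psi>)\<^sup>2 * \<rho> * t + 4 * (1 + \<psi>)\<^sup>2 * \<rho> * t * t"
    using t(1) by (simp add: field_simps)
  also have "\<dots> \<le> t * (1 + \<psi>)\<^sup>2 * V + 4 * (1 + \<psi>)\<^sup>2 * \<rho> * t + 4 * (1 + \<psi>)\<^sup>2 * \<rho> * t * 1"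
    using t(1,2) \<rho> by (intro add_mono mult_left_mono) auto
  also have "\<dots> = (1 + \<psi>)\<^sup>2 * (V + 8 * \<rho>) * t"
    by (simp add: algebra_simps)
  finally show ?thesis
    by (simp add: decomp c_def q_def p_def V_def \<rho>_def t_def)
qed

end

subsection \<open>Averaging over the prior\<close>

text \<open>The integrand depends on the parameter as well as the measure does. Pushing
  \<open>L x\<close> forward along \<open>y \<mapsto> (x, y)\<close> moves this dependence into the
  kernel and leaves a fixed integrand.\<close>

lemma integral_measurable_subprob_algebra2:
  fixes f :: "'a \<Rightarrow> 'b \<Rightarrow> real"
  assumes f [measurable]: "(\<lambda>(x, y). f x y) \<in> borel_measurable (M \<Otimes>\<^sub>M N)"
    and L [measurable]: "L \<in> M \<rightarrow>\<^sub>M subprob_algebra N"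
  shows "(\<lambda>x. integral\<^sup>L (L x) (f x)) \<in> borel_measurable M"
proof -
  note measurable_distr2 [measurable]
  have "(\<lambda>x. integral\<^sup>L (distr (L x) (M \<Otimes>\<^sub>M N) (\<lambda>y. (x, y))) (\<lambda>(x, y). f x y)) \<in> borel_measurable M"
    by measurable
  then show ?thesis
    by (rule measurable_cong [THEN iffD1, rotated])
      (simp add: integral_distr subprob_measurableD(3)[OF L])
qed

definition mean_shared_variance :: "'a crowd_model \<Rightarrow> real" where
  "mean_shared_variance C = (\<integral>\<theta>. shared_variance C \<theta> \<partial>prior C)"

locale nested_symmetric =
  fixes C :: "'a crowd_model"
  assumes model: "nested_symmetric_model C"
begin

sublocale prob_space "prior C"
  using model by (simp add: nested_symmetric_model_def)

lemma sets_prior [measurable_cong]: "sets (prior C) = sets borel"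
  using model by (simp add: nested_symmetric_model_def)

lemma prior_square: "integrable (prior C) (\<lambda>\<theta>. \<theta>\<^sup>2)"
  using model by (simp add: nested_symmetric_model_def)

lemma measurable_cond: "cond C \<in> prior C \<rightarrow>\<^sub>M prob_algebra (sample_space C)"
  using model by (simp add: nested_symmetric_model_def)

lemma measurable_cond_subprob [measurable]:
  "cond C \<in> prior C \<rightarrow>\<^sub>M subprob_algebra (sample_space C)"
  using measurable_cond by (rule measurable_prob_algebraD)

lemma nondegenerate:
  "0 < n_prior C \<and> 0 < prior_variance C \<or>
   0 < n_public C \<and> 0 < (\<integral>\<theta>. X_variance C \<theta> \<partial>prior C)"
  using model by (simp add: nested_symmetric_model_def)

lemma n_prior_nonneg: "0 \<le> n_prior C"
  using model by (simp add: nested_symmetric_model_def)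

lemma n_shared_pos: "0 < n_shared C"
  using nondegenerate n_prior_nonneg by (auto simp: n_shared_def)

lemma integrable_X_variance: "integrable (prior C) (X_variance C)"
  using model by (simp add: nested_symmetric_model_def)

lemma AE_conditional_crowd: "AE \<theta> in prior C. conditional_crowd C \<theta>"
proof -
  have "AE \<theta> in prior C. prob_space (cond C \<theta>)"
    using measurable_space[OF measurable_cond] by (auto simp: space_prob_algebra)
  moreover have "AE \<theta> in prior C.
        integrable (X_law C \<theta>) (\<lambda>x. x\<^sup>2) \<and> (\<integral>x. x \<partial>X_law C \<theta>) = \<theta> \<and>
        prob_space.indep_vars (cond C \<theta>) (\<lambda>_. borel)
          (case_sum (pub_obs C) (case_prod (priv_obs C))) UNIV \<and>
        (\<forall>i. distr (cond C \<theta>) borel (pub_obs C i) = X_law C \<theta>) \<and>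
        (\<forall>j i. distr (cond C \<theta>) borel (priv_obs C j i) = X_law C \<theta>) \<and>
        prob_space.indep_vars (cond C \<theta>) (\<lambda>_. borel) (case_prod (err C)) UNIV \<and>
        (\<forall>k j. distr (cond C \<theta>) borel (err C k j) = err_law C k)"
    using model unfolding nested_symmetric_model_def by (elim conjE)
  moreover have "\<And>k. integrable (err_law C k) (\<lambda>x. x\<^sup>2)" "\<And>k. (\<integral>x. x \<partial>err_law C k) = 0"
    using model by (simp_all add: nested_symmetric_model_def)
  ultimately show ?thesis
    using n_shared_pos
    by (auto simp: conditional_crowd_def conditional_crowd_axioms_def)
qed

text \<open>Independence supplies measurability under \<open>cond C \<theta>\<close> for good
  \<theta>. All these measures share the sigma-algebra of \<open>sample_space C\<close>, so one good
  \<theta> suffices; one exists because \<open>False\<close> cannot hold almost surely under a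
  probability measure.\<close>

lemma measurable_observations:
  shows measurable_pub [measurable]: "pub_obs C i \<in> borel_measurable (sample_space C)"
    and measurable_priv [measurable]: "priv_obs C j i \<in> borel_measurable (sample_space C)"
    and measurable_err [measurable]: "err C k j \<in> borel_measurable (sample_space C)"
proof -
  obtain \<theta> where \<theta>: "\<theta> \<in> space (prior C)" "conditional_crowd C \<theta>"
  proof (rule ccontr)
    assume "\<not> thesis"
    then have "\<forall>\<theta>\<in>space (prior C). \<not> conditional_crowd C \<theta>"
      using that by blast
    then have "AE \<theta> in prior C. False"
      using AE_conditional_crowd by (auto elim: AE_mp)
    then show False by simp
  qed
  note conditional_crowd.measurable_pub[OF \<theta>(2)] conditional_crowd.measurable_priv[OF \<theta>(2)]
    conditional_crowd.measurable_err[OF \<theta>(2)]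
  then show "pub_obs C i \<in> borel_measurable (sample_space C)"
    "priv_obs C j i \<in> borel_measurable (sample_space C)"
    "err C k j \<in> borel_measurable (sample_space C)"
    unfolding subprob_measurableD(3)[OF measurable_cond_subprob \<theta>(1)] by simp_all
qed

lemma measurable_conditional_mse [measurable]:
  "(\<lambda>\<theta>. \<integral>\<omega>. (pivot_estimator \<psi> C A J \<theta> \<omega> - \<theta>)\<^sup>2 \<partial>cond C \<theta>) \<in> borel_measurable (prior C)"
proof (rule integral_measurable_subprob_algebra2[OF _ measurable_cond_subprob])
  have [measurable]: "(\<lambda>(\<theta>, \<omega>). private_signal C \<theta> j \<omega>)
      \<in> borel_measurable (prior C \<Otimes>\<^sub>M sample_space C)" for j
    by (cases "n_private C") (simp_all add: private_signal_def sample_mean_def)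
  have [measurable]: "shared_info C \<in> borel_measurable (sample_space C)"
    unfolding shared_info_def[abs_def] sample_mean_def by measurable
  have [measurable]: "(\<lambda>(\<theta>, \<omega>). prediction C A \<theta> j \<omega>)
      \<in> borel_measurable (prior C \<Otimes>\<^sub>M sample_space C)" for j
    by (cases "j \<in> A") (simp_all add: prediction_def Let_def)
  have [measurable]: "(\<lambda>(\<theta>, \<omega>). peer_prediction C A J \<theta> j \<omega>)
      \<in> borel_measurable (prior C \<Otimes>\<^sub>M sample_space C)" for j
    by (cases "j \<in> A") (simp_all add: peer_prediction_def Let_def)
  show "(\<lambda>(\<theta>, \<omega>). (pivot_estimator \<psi> C A J \<theta> \<omega> - \<theta>)\<^sup>2)
      \<in> borel_measurable (prior C \<Otimes>\<^sub>M sample_space C)"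
    unfolding pivot_estimator_def mean_prediction_def mean_peer_prediction_def by measurable
qed

lemma integrable_prior_deviation: "integrable (prior C) (\<lambda>\<theta>. (prior_mean C - \<theta>)\<^sup>2)"
  using integrable_square_add[of "\<lambda>_. prior_mean C" "prior C" "\<lambda>\<theta>. - \<theta>"] prior_square by simp

lemma integrable_shared_variance: "integrable (prior C) (shared_variance C)"
  unfolding shared_variance_def[abs_def] power_mult_distrib
  using integrable_prior_deviation integrable_X_variance by simp

lemma integrable_noise_variance: "integrable (prior C) (noise_variance C)"
  unfolding noise_variance_def[abs_def] using integrable_X_variance by simp

text \<open>Strict positivity lets this factor be cancelled when limits are compared. Each
  alternative of \<open>nondegenerate\<close> makes one of the two nonnegative summands
  positive.\<close>

lemma mean_shared_variance_pos: "0 < mean_shared_variance C"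
proof -
  have "mean_shared_variance C = ((n_prior C)\<^sup>2 * prior_variance C
      + real (n_public C) * (\<integral>\<theta>. X_variance C \<theta> \<partial>prior C)) / (n_shared C)\<^sup>2"
    unfolding mean_shared_variance_def shared_variance_def power_mult_distrib
    using integrable_prior_deviation integrable_X_variance
    by (simp add: prior_variance_def power2_commute)
  moreover have "0 \<le> prior_variance C" "0 \<le> (\<integral>\<theta>. X_variance C \<theta> \<partial>prior C)"
    by (simp_all add: prior_variance_def X_variance_nonneg)
  ultimately show ?thesis
    using nondegenerate n_shared_pos
    by (auto intro!: divide_pos_pos intro: add_pos_nonneg add_nonneg_pos)
qed

lemma mse_bound:
  assumes A: "A \<subseteq> {..<J}" and J: "J > 0" and \<psi>: "\<psi> \<ge> 0" and w: "private_weight C \<in> {0..1}"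
  shows "\<bar>mse C (pivot_estimator \<psi> C A J)
       - (limit_factor \<psi> (maven_proportion A J * private_weight C))\<^sup>2 * mean_shared_variance C\<bar>
     \<le> (1 + \<psi>)\<^sup>2 * (\<integral>\<theta>. shared_variance C \<theta> + 8 * noise_variance C \<theta> \<partial>prior C) / sqrt (real J)"
proof -
  let ?M = "\<lambda>\<theta>. \<integral>\<omega>. (pivot_estimator \<psi> C A J \<theta> \<omega> - \<theta>)\<^sup>2 \<partial>cond C \<theta>"
  let ?c = "(limit_factor \<psi> (maven_proportion A J * private_weight C))\<^sup>2"
  let ?B = "\<lambda>\<theta>. (1 + \<psi>)\<^sup>2 * (shared_variance C \<theta> + 8 * noise_variance C \<theta>) / sqrt (real J)"
  have bound: "AE \<theta> in prior C. \<bar>?M \<theta> - ?c * shared_variance C \<theta>\<bar> \<le> ?B \<theta>"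
    using AE_conditional_crowd
    by eventually_elim (rule conditional_crowd.conditional_mse_bound[OF _ A J \<psi> w])
  have intB: "integrable (prior C) ?B"
    using integrable_shared_variance integrable_noise_variance by simp
  have [measurable]: "shared_variance C \<in> borel_measurable (prior C)"
    using integrable_shared_variance by blast
  \<comment> \<open>Integrability of the conditional error \<open>?M\<close> is obtained indirectly:
    its distance from a multiple of \<open>shared_variance C\<close> is dominated by the integrable
    \<open>?B\<close>. Only then may the integral of the difference be split.\<close>
  have intD: "integrable (prior C) (\<lambda>\<theta>. ?M \<theta> - ?c * shared_variance C \<theta>)"
  proof (rule Bochner_Integration.integrable_bound[OF intB])
    show "AE \<theta> in prior C. norm (?M \<theta> - ?c * shared_variance C \<theta>) \<le> norm (?B \<theta>)"
      using bound unfolding real_norm_def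
      by eventually_elim (rule order_trans[OF _ abs_ge_self])
  qed measurable
  then have "integrable (prior C) (\<lambda>\<theta>. ?M \<theta> - ?c * shared_variance C \<theta> + ?c * shared_variance C \<theta>)"
    using integrable_shared_variance by (intro Bochner_Integration.integrable_add) auto
  then have "integrable (prior C) ?M" by simp
  then have "mse C (pivot_estimator \<psi> C A J) - ?c * mean_shared_variance C
      = (\<integral>\<theta>. ?M \<theta> - ?c * shared_variance C \<theta> \<partial>prior C)"
    using integrable_shared_variance by (simp add: mse_def mean_shared_variance_def)
  also have "\<bar>\<dots>\<bar> \<le> (\<integral>\<theta>. ?B \<theta> \<partial>prior C)"
    using bound intD intB
    by (intro order_trans[OF integral_abs_bound] integral_mono_AE) auto
  finally show ?thesis by simp
qed

text \<open>The approximation along the actual proportions has vanishing error by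
  \<open>mse_bound\<close>, and \<open>limit_factor\<close> is continuous in the proportion.\<close>

lemma mse_tendsto:
  assumes A: "\<And>J. A J \<subseteq> {..<J}" and p: "(\<lambda>J. maven_proportion (A J) J) \<longlonglongrightarrow> p"
    and \<psi>: "\<psi> \<ge> 0" and w: "private_weight C \<in> {0..1}"
  shows "(\<lambda>J. mse C (pivot_estimator \<psi> C (A J) J))
     \<longlonglongrightarrow> (limit_factor \<psi> (p * private_weight C))\<^sup>2 * mean_shared_variance C"
proof (rule Lim_transform)
  let ?c = "\<lambda>J. (limit_factor \<psi> (maven_proportion (A J) J * private_weight C))\<^sup>2 * mean_shared_variance C"
  show "?c \<longlonglongrightarrow> (limit_factor \<psi> (p * private_weight C))\<^sup>2 * mean_shared_variance C"
    unfolding limit_factor_def by (intro tendsto_intros p)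
  let ?K = "(1 + \<psi>)\<^sup>2 * (\<integral>\<theta>. shared_variance C \<theta> + 8 * noise_variance C \<theta> \<partial>prior C)"
  show "(\<lambda>J. mse C (pivot_estimator \<psi> C (A J) J) - ?c J) \<longlonglongrightarrow> 0"
  proof (rule Lim_null_comparison)
    show "\<forall>\<^sub>F J in sequentially. norm (mse C (pivot_estimator \<psi> C (A J) J) - ?c J)
        \<le> ?K / sqrt (real J)"
      using eventually_gt_at_top[of 0]
      by eventually_elim (use mse_bound[OF A _ \<psi> w] in auto)
    show "(\<lambda>J. ?K / sqrt (real J)) \<longlonglongrightarrow> 0"
      by (intro real_tendsto_divide_at_top[OF tendsto_const]
          filterlim_compose[OF sqrt_at_top filterlim_real_sequentially])
  qed
qed

end

section \<open>Comparison of the limiting errors\<close>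

lemma pivot_estimator_0: "pivot_estimator 0 = mean_prediction"
  by (simp add: pivot_estimator_def fun_eq_iff)

text \<open>At \<open>q = 1\<close> both factors vanish, so the violation for \<open>\<psi> > 2\<close> must be found at some
  \<open>q\<close> strictly between \<open>2/\<psi>\<close> and \<open>1\<close>.\<close>

lemma limit_factor_le_iff:
  assumes \<psi>: "\<psi> \<ge> 0"
  shows "(\<forall>q\<in>{0..1}. (limit_factor \<psi> q)\<^sup>2 \<le> (limit_factor 0 q)\<^sup>2) \<longleftrightarrow> \<psi> \<le> 2"
proof
  assume le: "\<forall>q\<in>{0..1}. (limit_factor \<psi> q)\<^sup>2 \<le> (limit_factor 0 q)\<^sup>2"
  show "\<psi> \<le> 2"
  proof (rule ccontr)
    assume "\<not> \<psi> \<le> 2"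
    then have "2 / \<psi> < 1" by simp
    then obtain q where q: "2 / \<psi> < q" "q < 1" using dense by blast
    then have "0 < q" using \<psi> by (meson divide_nonneg_nonneg le_less_trans zero_le_numeral)
    have "2 < \<psi> * q" using q \<open>\<not> \<psi> \<le> 2\<close> by (simp add: field_simps)
    then have "1\<^sup>2 < (\<psi> * q - 1)\<^sup>2" by (intro power_strict_mono) auto
    then have "(1 - q)\<^sup>2 * 1 < (1 - q)\<^sup>2 * (1 - \<psi> * q)\<^sup>2"
      using q by (intro mult_strict_left_mono) (auto simp: power2_commute)
    moreover have "(limit_factor \<psi> q)\<^sup>2 \<le> (limit_factor 0 q)\<^sup>2"
      using le q \<open>0 < q\<close> by auto
    ultimately show False by (simp add: limit_factor_def power_mult_distrib)
  qed
next
  assume "\<psi> \<le> 2"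
  show "\<forall>q\<in>{0..1}. (limit_factor \<psi> q)\<^sup>2 \<le> (limit_factor 0 q)\<^sup>2"
  proof
    fix q :: real assume q: "q \<in> {0..1}"
    \<comment> \<open>The factor \<open>1 - \<psi> * q\<close> then lies between -1 and 1:
      overshooting zero does no harm as long as it stays within the unit interval in absolute
      value.\<close>
    have "0 \<le> \<psi> * q" "\<psi> * q \<le> 2 * 1"
      using \<psi> q \<open>\<psi> \<le> 2\<close> by (simp, intro mult_mono) auto
    then have "(1 - \<psi> * q)\<^sup>2 \<le> 1"
      by (simp add: abs_square_le_1 abs_le_iff)
    then have "(1 - q)\<^sup>2 * (1 - \<psi> * q)\<^sup>2 \<le> (1 - q)\<^sup>2 * 1"
      by (intro mult_left_mono) auto
    then show "(limit_factor \<psi> q)\<^sup>2 \<le> (limit_factor 0 q)\<^sup>2"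
      by (simp add: limit_factor_def power_mult_distrib)
  qed
qed

text \<open>Convergence is asserted separately because \<open>lim\<close> is meaningful only for
  convergent sequences. Maven proportions are required to tend to \<open>p\<close>, as
  \<open>p * J\<close> need not be an integer.\<close>

theorem theorem1:
  fixes C :: "real \<Rightarrow> 'a crowd_model"
    and mavens :: "real \<Rightarrow> nat \<Rightarrow> nat set"
    and \<psi> :: real
  assumes model: "\<And>w. w \<in> {0..1} \<Longrightarrow> nested_symmetric_model (C w)"
    and weight: "\<And>w. w \<in> {0..1} \<Longrightarrow> private_weight (C w) = w"
    and mavens: "\<And>p J. p \<in> {0..1} \<Longrightarrow> mavens p J \<subseteq> {..<J}"
    and proportion:
      "\<And>p. p \<in> {0..1} \<Longrightarrow> (\<lambda>J. maven_proportion (mavens p J) J) \<longlonglongrightarrow> p"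
    and psi: "\<psi> \<ge> 0"
  shows
    "(\<forall>w\<in>{0..1}. \<forall>p\<in>{0..1}.
        convergent (\<lambda>J. mse (C w) (pivot_estimator \<psi> (C w) (mavens p J) J)) \<and>
        convergent (\<lambda>J. mse (C w) (mean_prediction (C w) (mavens p J) J))) \<and>
     ((\<forall>w\<in>{0..1}. \<forall>p\<in>{0..1}.
        lim (\<lambda>J. mse (C w) (pivot_estimator \<psi> (C w) (mavens p J) J))
          \<le> lim (\<lambda>J. mse (C w) (mean_prediction (C w) (mavens p J) J)))
      \<longleftrightarrow> \<psi> \<in> {0..2})"
proof -
  have lims: "(\<lambda>J. mse (C w) (pivot_estimator \<phi> (C w) (mavens p J) J))
      \<longlonglongrightarrow> (limit_factor \<phi> (p * w))\<^sup>2 * mean_shared_variance (C w)"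
    if "w \<in> {0..1}" "p \<in> {0..1}" "\<phi> \<ge> 0" for w p \<phi>
    using nested_symmetric.mse_tendsto[OF nested_symmetric.intro[OF model] mavens proportion]
      weight that by simp
  note pivot = lims[OF _ _ psi] and mean = lims[where \<phi> = 0, unfolded pivot_estimator_0]
  have le_iff: "lim (\<lambda>J. mse (C w) (pivot_estimator \<psi> (C w) (mavens p J) J))
          \<le> lim (\<lambda>J. mse (C w) (mean_prediction (C w) (mavens p J) J))
      \<longleftrightarrow> (limit_factor \<psi> (p * w))\<^sup>2 \<le> (limit_factor 0 (p * w))\<^sup>2"
    if "w \<in> {0..1}" "p \<in> {0..1}" for w p
    using limI[OF pivot[OF that]] limI[OF mean[OF that]]
      nested_symmetric.mean_shared_variance_pos[OF nested_symmetric.intro[OF model[OF that(1)]]]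
    by simp
  have "(\<forall>w\<in>{0..1}. \<forall>p\<in>{0..1}.
        lim (\<lambda>J. mse (C w) (pivot_estimator \<psi> (C w) (mavens p J) J))
          \<le> lim (\<lambda>J. mse (C w) (mean_prediction (C w) (mavens p J) J)))
      \<longleftrightarrow> (\<forall>w\<in>{0..1}. \<forall>p\<in>{0..1}. (limit_factor \<psi> (p * w))\<^sup>2 \<le> (limit_factor 0 (p * w))\<^sup>2)"
    by (simp add: le_iff)
  also have "\<dots> \<longleftrightarrow> (\<forall>q\<in>{0..1}. (limit_factor \<psi> q)\<^sup>2 \<le> (limit_factor 0 q)\<^sup>2)"
  proof (intro iffI ballI)
    fix q :: real
    assume "\<forall>w\<in>{0..1}. \<forall>p\<in>{0..1}. (limit_factor \<psi> (p * w))\<^sup>2 \<le> (limit_factor 0 (p * w))\<^sup>2"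
      and "q \<in> {0..1}"
    \<comment> \<open>Every \<open>q\<close> in the unit interval occurs as \<open>p * w\<close>, by
      taking \<open>w = 1\<close> and \<open>p = q\<close>.\<close>
    then show "(limit_factor \<psi> q)\<^sup>2 \<le> (limit_factor 0 q)\<^sup>2"
      by (metis atLeastAtMost_iff mult.right_neutral order_refl zero_le_one)
  qed (simp add: mult_le_one)
  also have "\<dots> \<longleftrightarrow> \<psi> \<in> {0..2}"
    using limit_factor_le_iff[OF psi] psi by simp
  finally have "(\<forall>w\<in>{0..1}. \<forall>p\<in>{0..1}.
        lim (\<lambda>J. mse (C w) (pivot_estimator \<psi> (C w) (mavens p J) J))
          \<le> lim (\<lambda>J. mse (C w) (mean_prediction (C w) (mavens p J) J))) \<longleftrightarrow> \<psi> \<in> {0..2}" .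
  then show ?thesis
    using convergentI[OF pivot] convergentI[OF mean] by blast
qed

end
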